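(* Consider either the SAV-MD-BDFk method ($1\le k\le4$) or the VC-SAV-MD-BDF1 method (both written out in the context), and let $(\vec X^{m},\mu^m,\kappa^m)$, $\vec{\overline X}^{m}$, $\overline\mu^{m}$, $R^m$, $\zeta^m$, $\eta^m$ be the quantities they produce. Given the energy $R^m\ge0$, the following hold. (i) $R^{m+1}\ge0$ and $\zeta^{m+1}\ge0$ for all $m\ge0$. (ii) The energy $R^{m+1}$ is unconditionally stable in the sense that $$R^{m+1}-R^m=-\Delta t\,\zeta^{m+1}\big(\nabla_{\mathcal S}\overline\mu^{m+1},\nabla_{\mathcal S}\overline\mu^{m+1}\big)^h_{\overline{\mathcal S}^{m+1}}\le0\qquad\forall m\ge0.$$ (iii) The original energy is bounded: $$W(\vec X^m)\le M_r^2\qquad\forall m\ge0,$$ where $M_r$ is a positive constant that depends on $r$.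
   Context: Triangulated surfaces. All discrete surfaces are closed, oriented polygonal surfaces in $\mathbb R^3$ with the same connectivity as the initial one $\mathcal S^0$. Such a surface $\mathcal S=\bigcup_{l=1}^L\overline\sigma_l$ consists of $L$ mutually disjoint non-degenerate triangles $\sigma_l=\Delta\{\vec q_{l_1},\vec q_{l_2},\vec q_{l_3}\}$ (vertices ordered anticlockwise), with $\mathscr T\{\sigma_l\}=(\vec q_{l_2}-\vec q_{l_1})\times(\vec q_{l_3}-\vec q_{l_1})$, area $|\sigma_l|=\frac12|\mathscr T\{\sigma_l\}|$ and unit outward normal $\vec n_l=\mathscr T\{\sigma_l\}/|\mathscr T\{\sigma_l\}|$. Superscripts $m$, tildes and bars denote quantities on $\mathcal S^m$, $\widetilde{\mathcal S}^{m}$, $\overline{\mathcal S}^{m}$, which are the images of $\mathcal S^0$ under the piecewise linear maps $\vec X^m$, $\vec{\widetilde X}^{m}$, $\vec{\overline X}^{m}$. Time step $\Delta t>0$, $t_m=m\Delta t$; $\vec{\mathrm{id}}$ is the identity function on the surface. $\mathbb K(\mathcal S)$: continuous functions on $\mathcal S$ affine on each triangle. $\nabla_{\mathcal S}$: elementwise surface gradient ($\nabla_{\mathcal S}\vec f=(\nabla_{\mathcal S}f_1,\nabla_{\mathcal S}f_2,\nabla_{\mathcal S}f_3)^T$). Mass-lumped inner product: $(f,g)^h_{\mathcal S}=\frac13\sum_{l}\sum_{i=1}^3|\sigma_l|f((\vec q_{l_i})^-)g((\vec q_{l_i})^-)$ with one-sided limits from inside $\sigma_l$ (Euclidean/Frobenius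 product for vector/matrix arguments). Finite element functions are carried between surfaces by keeping their nodal values. Averaged normal $\vec v\in[\mathbb K(\mathcal S)]^3$: at the vertex $\vec q_k$, the normalization to unit length of $\sum_{\sigma_l:\,\vec q_k\in\overline\sigma_l}|\sigma_l|\vec n_l$. Anisotropy: $\gamma:\mathbb S^2\to(0,\infty)$ is the surface energy density, extended by $\gamma(\vec p)=|\vec p|\gamma(\vec p/|\vec p|)$ for $\vec p\neq0$, $\gamma(0)=0$; $\vec\xi(\vec n)=\nabla\gamma(\vec p)|_{\vec p=\vec n}$; $\mathbf Z(\vec n)=\gamma(\vec n)\mathbf I-\vec n\vec\xi^T-\vec\xi\vec n^T+s(\vec n)\vec n\vec n^T$ with $s$ a stability function making $\mathbf Z$ positive definite. On a surface $\mathcal S$, $\mathbf J=\nabla_{\mathcal S}\vec Y^0(\nabla_{\mathcal S}\vec Y^0)^T+\vec n\vec n^T$ elementwise, where $\vec Y^0\in[\mathbb K(\mathcal S)]^3$ takes at each vertex the value of the corresponding vertex of $\mathcal S^0$. Energies: for a piecewise linear parametrization $\vec X$ of a triangulated surface, $W(\vec X)=\sum_{l=1}^L|\sigma_l|\gamma(\vec n_l)$ and $W_c(\vec X)=W(\vec X)+C$, with $C>0$ a fixed constant. $r$ is a fixed positive integer. $R^0=W_c(\vec X^0)$. BDF coefficients: $\alpha_1=1$, $A_1(\vec\chi^m)=\vec\chi^m$; $\alpha_2=\frac32$, $A_2(\vec\chi^m)=2\vec\chi^m-\frac12\vec\chi^{m-1}$; $\alpha_3=\frac{11}6$, $A_3(\vec\chi^m)=3\vec\chi^m-\frac32\vec\chi^{m-1}+\frac13\vec\chi^{m-2}$;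 $\alpha_4=\frac{25}{12}$, $A_4(\vec\chi^m)=4\vec\chi^m-3\vec\chi^{m-1}+\frac43\vec\chi^{m-2}-\frac14\vec\chi^{m-3}$. SAV-MD-BDFk method. Given an approximating surface $\widetilde{\mathcal S}^{m+1}=\vec{\widetilde X}^{m+1}(\mathcal S^0)$ (equal to $\mathcal S^m$ if $k=1$, predicted by a lower-order method if $k\ge2$), $\vec\chi^{m-d}=\vec X^{m-d}\circ(\vec{\widetilde X}^{m+1})^{-1}\in[\mathbb K(\widetilde{\mathcal S}^{m+1})]^3$ for $d=0,\dots,k-1$, and $R^m$, find $\vec{\overline\chi}^{m+1}\in[\mathbb K(\widetilde{\mathcal S}^{m+1})]^3$, $\overline\mu^{m+1},\overline\kappa^{m+1}\in\mathbb K(\widetilde{\mathcal S}^{m+1})$, then $\vec{\overline X}^{m+1}$, $\zeta^{m+1}$, $R^{m+1}$, $\eta^{m+1}$, $\vec X^{m+1},\mu^{m+1},\kappa^{m+1}$ with (a) $\big(\frac{\alpha_k\vec{\overline\chi}^{m+1}-A_k(\vec\chi^m)}{\Delta t}\cdot\vec{\widetilde v}^{m+1},\varphi\big)^h_{\widetilde{\mathcal S}^{m+1}}+(\nabla_{\mathcal S}\overline\mu^{m+1},\nabla_{\mathcal S}\varphi)^h_{\widetilde{\mathcal S}^{m+1}}=0$ for all $\varphi\in\mathbb K(\widetilde{\mathcal S}^{m+1})$; (b) $(\overline\mu^{m+1},\phi)^h_{\widetilde{\mathcal S}^{m+1}}-\big(\mathbf Z(\vec{\widetilde n}^{m+1})\nabla_{\mathcal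 S}\vec{\overline\chi}^{m+1},\nabla_{\mathcal S}(\vec{\widetilde v}^{m+1}\phi)\big)^h_{\widetilde{\mathcal S}^{m+1}}=0$ for all $\phi\in\mathbb K(\widetilde{\mathcal S}^{m+1})$; (c) $\big(\overline\kappa^{m+1},\vec{\widetilde v}^{m+1}\cdot\vec\omega\sqrt{\det\widetilde{\mathbf J}^{m+1}}\big)^h_{\widetilde{\mathcal S}^{m+1}}+\big(\nabla_{\mathcal S}\vec{\overline\chi}^{m+1}(\widetilde{\mathbf J}^{m+1})^{-1},\nabla_{\mathcal S}\vec\omega\sqrt{\det\widetilde{\mathbf J}^{m+1}}\big)^h_{\widetilde{\mathcal S}^{m+1}}=0$ for all $\vec\omega\in[\mathbb K(\widetilde{\mathcal S}^{m+1})]^3$; (d) $\vec{\overline X}^{m+1}=\vec{\overline\chi}^{m+1}\circ\vec{\widetilde X}^{m+1}$, and $\overline{\mathcal S}^{m+1}=\vec{\overline X}^{m+1}(\mathcal S^0)$; (e) $\frac{R^{m+1}-R^m}{\Delta t}=-\zeta^{m+1}(\nabla_{\mathcal S}\overline\mu^{m+1},\nabla_{\mathcal S}\overline\mu^{m+1})^h_{\overline{\mathcal S}^{m+1}}$ with $\zeta^{m+1}=R^{m+1}/W_c(\vec{\overline X}^{m+1})$; (f) $\eta^{m+1}=1-(1-\zeta^{m+1})^r$; (g) $\vec X^{m+1}=\eta^{m+1}\vec{\overline X}^{m+1}$, $\mu^{m+1}=\eta^{m+1}\overline\mu^{m+1}$, $\kappa^{m+1}=\eta^{m+1}\overline\kappa^{m+1}$.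 For $k\ge2$ the starting values $\vec X^1,\dots,\vec X^{k-1}$ (and $R^1,\dots,R^{k-1}$) are computed with the $k=1$ version. VC-SAV-MD-BDF1 method. The same scheme with $k=1$ and $\widetilde{\mathcal S}^{m+1}=\mathcal S^m$ (so tilded quantities are those of $\mathcal S^m$), except that (a) is replaced by $\big(\frac{\vec{\overline\chi}^{m+1}-\vec{\mathrm{id}}}{\Delta t}\cdot\vec n^{m+\frac12},\varphi\big)^h_{\mathcal S^m}+(\nabla_{\mathcal S}\overline\mu^{m+1},\nabla_{\mathcal S}\varphi)^h_{\mathcal S^m}=0$ for all $\varphi\in\mathbb K(\mathcal S^m)$, where $\vec n^{m+\frac12}$ is piecewise constant with $\vec n^{m+\frac12}_l=\frac{\mathscr T\{\sigma^m_l\}+4\mathscr T\{\sigma_l^{m+1/2}\}+\mathscr T\{\overline\sigma_l^{m+1}\}}{6|\mathscr T\{\sigma_l^m\}|}$, $\overline\sigma_l^{m+1}$ being the triangle of $\overline{\mathcal S}^{m+1}$ corresponding to $\sigma_l^m$ and $\sigma_l^{m+1/2}$ the triangle whose vertices are the midpoints of corresponding vertices of $\sigma_l^m$ and $\overline\sigma_l^{m+1}$. *)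

theory Defs
  imports "HOL-Analysis.Analysis"
begin


text \<open>
  A triangle is its ordered triple of vertices; a triangulated surface is a finite family of
  triangles, indexed by a finite type (whose cardinality is the number of triangles). A surface
  with the connectivity of a given one is the image of the vertices under a piecewise linear map.
\<close>

type_synonym triangle = "3 \<Rightarrow> real^3"
type_synonym 'l mesh = "'l \<Rightarrow> triangle"

definition closed_tri :: "triangle \<Rightarrow> (real^3) set" where
  "closed_tri t = convex hull (range t)"

definition open_tri :: "triangle \<Rightarrow> (real^3) set" where
  "open_tri t = rel_interior (closed_tri t)"

definition orient :: "triangle \<Rightarrow> real^3" where
  "orient t = cross3 (t 2 - t 1) (t 3 - t 1)"

definition area :: "triangle \<Rightarrow> real" where
  "area t = norm (orient t) / 2"

definition normal :: "triangle \<Rightarrow> real^3" where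
  "normal t = orient t /\<^sub>R norm (orient t)"

definition surface :: "'l::finite mesh \<Rightarrow> (real^3) set" where
  "surface q = (\<Union>l. closed_tri (q l))"

definition mesh_image :: "(real^3 \<Rightarrow> real^3) \<Rightarrow> 'l mesh \<Rightarrow> 'l mesh" where
  "mesh_image X q = (\<lambda>l i. X (q l i))"

text \<open>
  Closed, oriented polygonal surfaces: the triangles are non-degenerate, mutually disjoint and
  conforming (closed triangles meet exactly in their common face); the union is a topological
  2-manifold without boundary (compactness is automatic); it bounds a region \<open>\<Omega>\<close>, and the
  vertices of each triangle are ordered anticlockwise as seen from outside, i.e. the normal
  obtained from the vertex order points out of \<open>\<Omega>\<close>.
\<close>

definition closed_oriented_surface :: "'l::finite mesh \<Rightarrow> bool" where
  "closed_oriented_surface q \<longleftrightarrow>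
     (\<forall>l. orient (q l) \<noteq> 0) \<and>
     (\<forall>l l'. l \<noteq> l' \<longrightarrow> open_tri (q l) \<inter> open_tri (q l') = {}) \<and>
     (\<forall>l l'. closed_tri (q l) \<inter> closed_tri (q l') = convex hull (range (q l) \<inter> range (q l'))) \<and>
     (\<forall>x\<in>surface q. \<exists>U. x \<in> U \<and> openin (top_of_set (surface q)) U \<and>
        U homeomorphic (UNIV :: (real^2) set)) \<and>
     (\<exists>\<Omega>. open \<Omega> \<and> bounded \<Omega> \<and> frontier \<Omega> = surface q \<and>
        (\<forall>l. \<forall>x\<in>open_tri (q l). \<forall>\<^sub>F e in at_right 0.
           x - e *\<^sub>R normal (q l) \<in> \<Omega> \<and> x + e *\<^sub>R normal (q l) \<notin> closure \<Omega>))"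



text \<open>
  Functions on a surface are functions on the ambient space of which only the values on the surface
  matter. Taking values in \<open>real^3\<close> gives the vector-valued space.
\<close>

definition affine_on :: "(real^3) set \<Rightarrow> (real^3 \<Rightarrow> 'b::real_normed_vector) \<Rightarrow> bool" where
  "affine_on S f \<longleftrightarrow> (\<exists>A b. linear A \<and> (\<forall>x\<in>S. f x = A x + b))"

definition FE :: "'l::finite mesh \<Rightarrow> (real^3 \<Rightarrow> 'b::real_normed_vector) set" where
  "FE q = {f. continuous_on (surface q) f \<and> (\<forall>l. affine_on (closed_tri (q l)) f)}"

text \<open>\<open>S = X(S\<^sup>0)\<close> is an admissible discrete surface with the connectivity of \<open>S\<^sup>0\<close>.\<close>

definition surface_param :: "'l::finite mesh \<Rightarrow> (real^3 \<Rightarrow> real^3) \<Rightarrow> bool" where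
  "surface_param q0 X \<longleftrightarrow>
     X \<in> FE q0 \<and> inj_on X (surface q0) \<and> closed_oriented_surface (mesh_image X q0)"

definition carry :: "'l::finite mesh \<Rightarrow> 'l mesh \<Rightarrow> (real^3 \<Rightarrow> 'b::real_normed_vector) \<Rightarrow> (real^3 \<Rightarrow> 'b)" where
  "carry q q' f = (SOME g. g \<in> FE q' \<and> (\<forall>l i. g (q' l i) = f (q l i)))"

text \<open>
  Elementwise functions, possibly discontinuous across edges, have type
  \<open>'l \<Rightarrow> real^3 \<Rightarrow> 'b\<close>: the first argument selects the triangle. The surface gradient is the
  tangential vector representing the derivative along the triangle; it is also applied to products
  of finite element functions, for which it is not elementwise constant.
\<close>

definition sgrad :: "'l mesh \<Rightarrow> (real^3 \<Rightarrow> real) \<Rightarrow> 'l \<Rightarrow> real^3 \<Rightarrow> real^3" where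
  "sgrad q f l x = (THE g. g \<bullet> normal (q l) = 0 \<and>
      (f has_derivative (\<lambda>h. g \<bullet> h)) (at x within open_tri (q l)))"

definition vgrad :: "'l mesh \<Rightarrow> (real^3 \<Rightarrow> real^3) \<Rightarrow> 'l \<Rightarrow> real^3 \<Rightarrow> real^3^3" where
  "vgrad q f l x = (\<chi> i. sgrad q (\<lambda>y. f y $ i) l x)"

text \<open>The limit is the one-sided value at the vertex from inside the triangle; on matrices the
  library's inner product is the Frobenius product.\<close>

definition lumped :: "'l::finite mesh \<Rightarrow> ('l \<Rightarrow> real^3 \<Rightarrow> 'b::real_inner) \<Rightarrow> ('l \<Rightarrow> real^3 \<Rightarrow> 'b) \<Rightarrow> real" where
  "lumped q f g = 1/3 * (\<Sum>l\<in>UNIV. \<Sum>i\<in>UNIV. area (q l) *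
      (Lim (at (q l i) within open_tri (q l)) (f l) \<bullet> Lim (at (q l i) within open_tri (q l)) (g l)))"

definition vertex_normal :: "'l::finite mesh \<Rightarrow> real^3 \<Rightarrow> real^3" where
  "vertex_normal q p =
     (let w = (\<Sum>l\<in>{l. p \<in> closed_tri (q l)}. area (q l) *\<^sub>R normal (q l)) in w /\<^sub>R norm w)"

definition avg_normal :: "'l::finite mesh \<Rightarrow> real^3 \<Rightarrow> real^3" where
  "avg_normal q = (SOME v. v \<in> FE q \<and> (\<forall>l i. v (q l i) = vertex_normal q (q l i)))"



definition hom_ext :: "(real^3 \<Rightarrow> real) \<Rightarrow> real^3 \<Rightarrow> real" where
  "hom_ext \<gamma> p = (if p = 0 then 0 else norm p * \<gamma> (p /\<^sub>R norm p))"

definition xi :: "(real^3 \<Rightarrow> real) \<Rightarrow> real^3 \<Rightarrow> real^3" where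
  "xi \<gamma> n = (THE D. GDERIV (hom_ext \<gamma>) n :> D)"

definition outer :: "real^3 \<Rightarrow> real^3 \<Rightarrow> real^3^3" where
  "outer u v = (\<chi> i j. u $ i * v $ j)"

definition Zmat :: "(real^3 \<Rightarrow> real) \<Rightarrow> (real^3 \<Rightarrow> real) \<Rightarrow> real^3 \<Rightarrow> real^3^3" where
  "Zmat \<gamma> s n = \<gamma> n *\<^sub>R mat 1 - outer n (xi \<gamma> n) - outer (xi \<gamma> n) n + s n *\<^sub>R outer n n"

definition surface_energy_density :: "(real^3 \<Rightarrow> real) \<Rightarrow> bool" where
  "surface_energy_density \<gamma> \<longleftrightarrow>
     (\<forall>n. norm n = 1 \<longrightarrow> \<gamma> n > 0) \<and> (\<forall>p. p \<noteq> 0 \<longrightarrow> hom_ext \<gamma> differentiable (at p))"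

definition stability_function :: "(real^3 \<Rightarrow> real) \<Rightarrow> (real^3 \<Rightarrow> real) \<Rightarrow> bool" where
  "stability_function \<gamma> s \<longleftrightarrow>
     (\<forall>n. norm n = 1 \<longrightarrow> (\<forall>x. x \<noteq> 0 \<longrightarrow> x \<bullet> (Zmat \<gamma> s n *v x) > 0))"

definition Jmat :: "'l::finite mesh \<Rightarrow> 'l mesh \<Rightarrow> 'l \<Rightarrow> real^3 \<Rightarrow> real^3^3" where
  "Jmat q0 q l x =
     (let G = vgrad q (carry q0 q (\<lambda>y. y)) l x
      in G ** transpose G + outer (normal (q l)) (normal (q l)))"

definition W :: "(real^3 \<Rightarrow> real) \<Rightarrow> 'l::finite mesh \<Rightarrow> (real^3 \<Rightarrow> real^3) \<Rightarrow> real" where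
  "W \<gamma> q0 X = (\<Sum>l\<in>UNIV. area (mesh_image X q0 l) * \<gamma> (normal (mesh_image X q0 l)))"

definition Wc :: "(real^3 \<Rightarrow> real) \<Rightarrow> real \<Rightarrow> 'l::finite mesh \<Rightarrow> (real^3 \<Rightarrow> real^3) \<Rightarrow> real" where
  "Wc \<gamma> C q0 X = W \<gamma> q0 X + C"



definition bdf_alpha :: "nat \<Rightarrow> real" where
  "bdf_alpha k = (if k = 1 then 1 else if k = 2 then 3/2 else if k = 3 then 11/6 else 25/12)"

text \<open>\<open>c d\<close> is the value at time level \<open>m - d\<close>; only \<open>1 \<le> k \<le> 4\<close> is used.\<close>

definition bdf_A :: "nat \<Rightarrow> (nat \<Rightarrow> real^3) \<Rightarrow> real^3" where
  "bdf_A k c =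
     (if k = 1 then c 0
      else if k = 2 then 2 *\<^sub>R c 0 - (1/2) *\<^sub>R c 1
      else if k = 3 then 3 *\<^sub>R c 0 - (3/2) *\<^sub>R c 1 + (1/3) *\<^sub>R c 2
      else 4 *\<^sub>R c 0 - 3 *\<^sub>R c 1 + (4/3) *\<^sub>R c 2 - (1/4) *\<^sub>R c 3)"

text \<open>
  All quantities produced by a method, indexed by the time level; \<open>Xt\<close> is \<open>X\<close> with a tilde, a
  trailing \<open>b\<close> stands for a bar. \<open>X\<close>, \<open>Xt\<close>, \<open>Xb\<close> are functions on the initial surface;
  \<open>chib\<close>, \<open>mub\<close>, \<open>kapb\<close> at level \<open>m + 1\<close> are functions on the tilded surface of that level;
  \<open>mu\<close>, \<open>kap\<close> are functions on the surface parametrized by \<open>X\<close>.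
\<close>

record sav_run =
  X_of :: "nat \<Rightarrow> real^3 \<Rightarrow> real^3"
  Xt_of :: "nat \<Rightarrow> real^3 \<Rightarrow> real^3"
  chib_of :: "nat \<Rightarrow> real^3 \<Rightarrow> real^3"
  Xb_of :: "nat \<Rightarrow> real^3 \<Rightarrow> real^3"
  mub_of :: "nat \<Rightarrow> real^3 \<Rightarrow> real"
  kapb_of :: "nat \<Rightarrow> real^3 \<Rightarrow> real"
  mu_of :: "nat \<Rightarrow> real^3 \<Rightarrow> real"
  kap_of :: "nat \<Rightarrow> real^3 \<Rightarrow> real"
  R_of :: "nat \<Rightarrow> real"
  zeta_of :: "nat \<Rightarrow> real"
  eta_of :: "nat \<Rightarrow> real"

definition mesh_X :: "'l::finite mesh \<Rightarrow> sav_run \<Rightarrow> nat \<Rightarrow> 'l mesh" where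
  "mesh_X q0 \<rho> m = mesh_image (X_of \<rho> m) q0"

definition mesh_Xt :: "'l::finite mesh \<Rightarrow> sav_run \<Rightarrow> nat \<Rightarrow> 'l mesh" where
  "mesh_Xt q0 \<rho> m = mesh_image (Xt_of \<rho> m) q0"

definition mesh_Xb :: "'l::finite mesh \<Rightarrow> sav_run \<Rightarrow> nat \<Rightarrow> 'l mesh" where
  "mesh_Xb q0 \<rho> m = mesh_image (Xb_of \<rho> m) q0"

text \<open>The squared lumped norm, on the barred surface, of the surface gradient of the
  chemical potential, which is carried there from the tilded surface by its nodal values.\<close>

definition dissipation :: "'l::finite mesh \<Rightarrow> sav_run \<Rightarrow> nat \<Rightarrow> real" where
  "dissipation q0 \<rho> m =
     (let q = mesh_Xb q0 \<rho> m; \<nu> = carry (mesh_Xt q0 \<rho> m) q (mub_of \<rho> m)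
      in lumped q (sgrad q \<nu>) (sgrad q \<nu>))"

definition initial_data :: "'l::finite mesh \<Rightarrow> (real^3 \<Rightarrow> real) \<Rightarrow> real \<Rightarrow> sav_run \<Rightarrow> bool" where
  "initial_data q0 \<gamma> C \<rho> \<longleftrightarrow>
     (\<forall>x\<in>surface q0. X_of \<rho> 0 x = x) \<and> R_of \<rho> 0 = Wc \<gamma> C q0 (X_of \<rho> 0)"

definition admissible_step :: "'l::finite mesh \<Rightarrow> sav_run \<Rightarrow> nat \<Rightarrow> bool" where
  "admissible_step q0 \<rho> m \<longleftrightarrow>
     surface_param q0 (Xt_of \<rho> (m+1)) \<and> surface_param q0 (Xb_of \<rho> (m+1)) \<and>
     surface_param q0 (X_of \<rho> (m+1)) \<and>
     chib_of \<rho> (m+1) \<in> FE (mesh_Xt q0 \<rho> (m+1)) \<and>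
     mub_of \<rho> (m+1) \<in> FE (mesh_Xt q0 \<rho> (m+1)) \<and>
     kapb_of \<rho> (m+1) \<in> FE (mesh_Xt q0 \<rho> (m+1))"

definition eq_a_bdf :: "nat \<Rightarrow> 'l::finite mesh \<Rightarrow> real \<Rightarrow> sav_run \<Rightarrow> nat \<Rightarrow> bool" where
  "eq_a_bdf k q0 \<Delta>t \<rho> m \<longleftrightarrow>
     (let q = mesh_Xt q0 \<rho> (m+1);
          \<chi>s = (\<lambda>d. X_of \<rho> (m - d) \<circ> inv_into (surface q0) (Xt_of \<rho> (m+1)))
      in \<forall>\<phi>\<in>FE q.
           lumped q
             (\<lambda>l x. ((bdf_alpha k *\<^sub>R chib_of \<rho> (m+1) x - bdf_A k (\<lambda>d. \<chi>s d x)) /\<^sub>R \<Delta>t) \<bullet> avg_normal q x)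
             (\<lambda>l x. \<phi> x)
           + lumped q (sgrad q (mub_of \<rho> (m+1))) (sgrad q \<phi>) = 0)"

definition n_half :: "'l::finite mesh \<Rightarrow> sav_run \<Rightarrow> nat \<Rightarrow> 'l \<Rightarrow> real^3" where
  "n_half q0 \<rho> m l =
     (let t = mesh_X q0 \<rho> m l; tb = mesh_Xb q0 \<rho> (m+1) l
      in (orient t + 4 *\<^sub>R orient (\<lambda>i. midpoint (t i) (tb i)) + orient tb) /\<^sub>R (6 * norm (orient t)))"

definition eq_a_vc :: "'l::finite mesh \<Rightarrow> real \<Rightarrow> sav_run \<Rightarrow> nat \<Rightarrow> bool" where
  "eq_a_vc q0 \<Delta>t \<rho> m \<longleftrightarrow>
     (let q = mesh_X q0 \<rho> m
      in \<forall>\<phi>\<in>FE q.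
           lumped q (\<lambda>l x. ((chib_of \<rho> (m+1) x - x) /\<^sub>R \<Delta>t) \<bullet> n_half q0 \<rho> m l) (\<lambda>l x. \<phi> x)
           + lumped q (sgrad q (mub_of \<rho> (m+1))) (sgrad q \<phi>) = 0)"

definition eq_b :: "'l::finite mesh \<Rightarrow> (real^3 \<Rightarrow> real) \<Rightarrow> (real^3 \<Rightarrow> real) \<Rightarrow> sav_run \<Rightarrow> nat \<Rightarrow> bool" where
  "eq_b q0 \<gamma> s \<rho> m \<longleftrightarrow>
     (let q = mesh_Xt q0 \<rho> (m+1)
      in \<forall>\<phi>\<in>FE q.
           lumped q (\<lambda>l x. mub_of \<rho> (m+1) x) (\<lambda>l x. \<phi> x)
           - lumped q (\<lambda>l x. Zmat \<gamma> s (normal (q l)) ** vgrad q (chib_of \<rho> (m+1)) l x)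
                      (vgrad q (\<lambda>x. \<phi> x *\<^sub>R avg_normal q x)) = 0)"

definition eq_c :: "'l::finite mesh \<Rightarrow> sav_run \<Rightarrow> nat \<Rightarrow> bool" where
  "eq_c q0 \<rho> m \<longleftrightarrow>
     (let q = mesh_Xt q0 \<rho> (m+1); J = Jmat q0 q
      in \<forall>\<omega>\<in>FE q.
           lumped q (\<lambda>l x. kapb_of \<rho> (m+1) x) (\<lambda>l x. (avg_normal q x \<bullet> \<omega> x) * sqrt (det (J l x)))
           + lumped q (\<lambda>l x. vgrad q (chib_of \<rho> (m+1)) l x ** matrix_inv (J l x))
                      (\<lambda>l x. sqrt (det (J l x)) *\<^sub>R vgrad q \<omega> l x) = 0)"

definition eq_d :: "'l::finite mesh \<Rightarrow> sav_run \<Rightarrow> nat \<Rightarrow> bool" where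
  "eq_d q0 \<rho> m \<longleftrightarrow>
     (\<forall>x\<in>surface q0. Xb_of \<rho> (m+1) x = chib_of \<rho> (m+1) (Xt_of \<rho> (m+1) x))"

definition eq_e :: "'l::finite mesh \<Rightarrow> (real^3 \<Rightarrow> real) \<Rightarrow> real \<Rightarrow> real \<Rightarrow> sav_run \<Rightarrow> nat \<Rightarrow> bool" where
  "eq_e q0 \<gamma> C \<Delta>t \<rho> m \<longleftrightarrow>
     (R_of \<rho> (m+1) - R_of \<rho> m) / \<Delta>t = - zeta_of \<rho> (m+1) * dissipation q0 \<rho> (m+1) \<and>
     zeta_of \<rho> (m+1) = R_of \<rho> (m+1) / Wc \<gamma> C q0 (Xb_of \<rho> (m+1))"

definition eq_f :: "nat \<Rightarrow> sav_run \<Rightarrow> nat \<Rightarrow> bool" where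
  "eq_f r \<rho> m \<longleftrightarrow> eta_of \<rho> (m+1) = 1 - (1 - zeta_of \<rho> (m+1)) ^ r"

definition eq_g :: "'l::finite mesh \<Rightarrow> sav_run \<Rightarrow> nat \<Rightarrow> bool" where
  "eq_g q0 \<rho> m \<longleftrightarrow>
     (let q = mesh_Xt q0 \<rho> (m+1); q' = mesh_X q0 \<rho> (m+1)
      in (\<forall>x\<in>surface q0. X_of \<rho> (m+1) x = eta_of \<rho> (m+1) *\<^sub>R Xb_of \<rho> (m+1) x) \<and>
         (\<forall>x\<in>surface q'. mu_of \<rho> (m+1) x = eta_of \<rho> (m+1) * carry q q' (mub_of \<rho> (m+1)) x) \<and>
         (\<forall>x\<in>surface q'. kap_of \<rho> (m+1) x = eta_of \<rho> (m+1) * carry q q' (kapb_of \<rho> (m+1)) x))"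

definition common_step ::
  "'l::finite mesh \<Rightarrow> (real^3 \<Rightarrow> real) \<Rightarrow> (real^3 \<Rightarrow> real) \<Rightarrow> real \<Rightarrow> nat \<Rightarrow> real \<Rightarrow> sav_run \<Rightarrow> nat \<Rightarrow> bool" where
  "common_step q0 \<gamma> s C r \<Delta>t \<rho> m \<longleftrightarrow>
     admissible_step q0 \<rho> m \<and> eq_b q0 \<gamma> s \<rho> m \<and> eq_c q0 \<rho> m \<and> eq_d q0 \<rho> m \<and>
     eq_e q0 \<gamma> C \<Delta>t \<rho> m \<and> eq_f r \<rho> m \<and> eq_g q0 \<rho> m"

definition tilde_is_current :: "'l::finite mesh \<Rightarrow> sav_run \<Rightarrow> nat \<Rightarrow> bool" where
  "tilde_is_current q0 \<rho> m \<longleftrightarrow> (\<forall>x\<in>surface q0. Xt_of \<rho> (m+1) x = X_of \<rho> m x)"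

text \<open>
  The steps producing the levels \<open>1, \<dots>, k - 1\<close> are steps of the method with \<open>k = 1\<close>. In the steps
  with \<open>k \<ge> 2\<close> the approximating (predicted) surface is input data: it may be any admissible
  discrete surface, in particular one predicted by any lower-order method.
\<close>

definition SAV_MD_BDF ::
  "nat \<Rightarrow> 'l::finite mesh \<Rightarrow> (real^3 \<Rightarrow> real) \<Rightarrow> (real^3 \<Rightarrow> real) \<Rightarrow> real \<Rightarrow> nat \<Rightarrow> real \<Rightarrow> sav_run \<Rightarrow> bool" where
  "SAV_MD_BDF k q0 \<gamma> s C r \<Delta>t \<rho> \<longleftrightarrow>
     initial_data q0 \<gamma> C \<rho> \<and>
     (\<forall>m. let j = (if m + 1 < k then 1 else k)
          in (j = 1 \<longrightarrow> tilde_is_current q0 \<rho> m) \<and> eq_a_bdf j q0 \<Delta>t \<rho> m \<and>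
             common_step q0 \<gamma> s C r \<Delta>t \<rho> m)"

definition VC_SAV_MD_BDF1 ::
  "'l::finite mesh \<Rightarrow> (real^3 \<Rightarrow> real) \<Rightarrow> (real^3 \<Rightarrow> real) \<Rightarrow> real \<Rightarrow> nat \<Rightarrow> real \<Rightarrow> sav_run \<Rightarrow> bool" where
  "VC_SAV_MD_BDF1 q0 \<gamma> s C r \<Delta>t \<rho> \<longleftrightarrow>
     initial_data q0 \<gamma> C \<rho> \<and>
     (\<forall>m. tilde_is_current q0 \<rho> m \<and> eq_a_vc q0 \<Delta>t \<rho> m \<and> common_step q0 \<gamma> s C r \<Delta>t \<rho> m)"

definition SAV_solution ::
  "'l::finite mesh \<Rightarrow> (real^3 \<Rightarrow> real) \<Rightarrow> (real^3 \<Rightarrow> real) \<Rightarrow> real \<Rightarrow> nat \<Rightarrow> real \<Rightarrow> sav_run \<Rightarrow> bool" where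
  "SAV_solution q0 \<gamma> s C r \<Delta>t \<rho> \<longleftrightarrow>
     (\<exists>k. 1 \<le> k \<and> k \<le> 4 \<and> SAV_MD_BDF k q0 \<gamma> s C r \<Delta>t \<rho>) \<or> VC_SAV_MD_BDF1 q0 \<gamma> s C r \<Delta>t \<rho>"

end

theory Submission
  imports Defs
begin

text \<open>
  The result rests on the scalar part of the scheme: the update of the auxiliary energy and the
  rescaling of the surface. Write \<open>D \<ge> 0\<close> for the lumped Dirichlet energy of the chemical potential and
  \<open>w = W\<^sub>c(X\<^sub>b) \<ge> C > 0\<close>. Since \<open>\<zeta> = R' / w\<close>, the update of the auxiliary energy reads
  \<open>R' (1 + \<Delta>t D / w) = R\<close>. The factor is at least one, so \<open>R \<ge> 0\<close> forces \<open>0 \<le> R' \<le> R\<close>,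
  whatever the time step and whatever the barred surface (\<open>auxiliary_energy_step\<close>). By induction
  every \<open>R\<close> stays between \<open>0\<close> and the initial value \<open>R\<^sup>0\<close>, which is determined by the initial
  surface alone (\<open>auxiliary_energy_bounds\<close>).

  The bound on the original energy comes from the rescaling \<open>X = \<eta> X\<^sub>b\<close>. The energy is homogeneous
  of degree two under dilations (\<open>W_dilation\<close>), so \<open>W(X) = \<eta>\<^sup>2 W(X\<^sub>b) \<le> \<eta>\<^sup>2 w\<close>. Now
  \<open>\<eta> = 1 - (1 - \<zeta>)\<^sup>r\<close> is divisible by \<open>\<zeta>\<close>, hence \<open>\<bar>\<eta>\<bar> \<le> B \<zeta> \<le> B R\<^sup>0 / w\<close>, where \<open>B\<close> depends only
  on \<open>r\<close> and on the bound \<open>R\<^sup>0 / C\<close> for \<open>\<zeta>\<close> (\<open>relaxation_factor_bound\<close>). The two powers of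
  \<open>1 / w\<close> beat the single power of \<open>w\<close>: \<open>W(X) \<le> (B R\<^sup>0)\<^sup>2 / w \<le> (B R\<^sup>0)\<^sup>2 / C\<close>.
\<close>

section \<open>The anisotropic energy of a triangulated surface\<close>

lemma vertex_in_surface: "q l i \<in> surface q"
  unfolding surface_def closed_tri_def by (auto intro: hull_inc)

lemma mesh_image_cong:
  assumes "\<And>x. x \<in> surface q \<Longrightarrow> X x = Y x"
  shows "mesh_image X q = mesh_image Y q"
  by (simp add: mesh_image_def assms vertex_in_surface)

lemma W_cong:
  assumes "\<And>x. x \<in> surface q \<Longrightarrow> X x = Y x"
  shows "W \<gamma> q X = W \<gamma> q Y"
  unfolding W_def using mesh_image_cong[of q X Y] assms by simp

text \<open>A degenerate triangle has normal zero, where the density is unconstrained; its area vanishes,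
  so it contributes nothing.\<close>

lemma W_nonneg:
  assumes "surface_energy_density \<gamma>"
  shows "0 \<le> W \<gamma> q X"
proof -
  have "0 \<le> area t * \<gamma> (normal t)" for t
  proof (cases "orient t = 0")
    case False
    then have "norm (normal t) = 1"
      by (simp add: normal_def)
    then have "0 < \<gamma> (normal t)"
      using assms by (simp add: surface_energy_density_def)
    then show ?thesis
      by (simp add: area_def)
  qed (simp add: area_def)
  then show ?thesis
    unfolding W_def by (intro sum_nonneg)
qed

lemma orient_dilation: "orient (\<lambda>i. c *\<^sub>R t i) = c\<^sup>2 *\<^sub>R orient t"
  by (simp add: orient_def scaleR_diff_right[symmetric] cross_mult_left cross_mult_right
      power2_eq_square)

text \<open>The vector area is quadratic in the vertices, so even a dilation with a negative factor keeps
  its direction; when the factor is zero both sides vanish.\<close>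

lemma W_dilation: "W \<gamma> q (\<lambda>x. c *\<^sub>R X x) = c\<^sup>2 * W \<gamma> q X"
proof -
  have "area (\<lambda>i. c *\<^sub>R t i) * \<gamma> (normal (\<lambda>i. c *\<^sub>R t i)) = c\<^sup>2 * (area t * \<gamma> (normal t))" for t
  proof (cases "c = 0")
    case False
    then have "normal (\<lambda>i. c *\<^sub>R t i) = normal t"
      by (simp add: normal_def orient_dilation)
    then show ?thesis
      by (simp add: area_def orient_dilation)
  next
    case True
    then show ?thesis
      using orient_dilation[of c t] by (simp add: area_def)
  qed
  then show ?thesis
    by (simp add: W_def mesh_image_def sum_distrib_left)
qed

section \<open>Decay of the auxiliary energy\<close>

lemma lumped_self_nonneg: "0 \<le> lumped q f f"
  unfolding lumped_def by (intro mult_nonneg_nonneg sum_nonneg) (auto simp: area_def)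

lemma dissipation_nonneg: "0 \<le> dissipation q0 \<rho> m"
  unfolding dissipation_def Let_def by (rule lumped_self_nonneg)

text \<open>Although the update is implicit in the new value, it is linear in it with coefficient
  \<open>1 + \<Delta>t D / w \<ge> 1\<close>; sign and monotonicity follow from dividing by that coefficient.\<close>

lemma auxiliary_energy_step:
  fixes R R' \<zeta> :: real
  assumes "0 < \<Delta>t" "0 < w" "0 \<le> D" "0 \<le> R"
    and step: "(R' - R) / \<Delta>t = - \<zeta> * D" and ratio: "\<zeta> = R' / w"
  shows "0 \<le> R'" "R' \<le> R" "0 \<le> \<zeta>"
    and "R' - R = - \<Delta>t * \<zeta> * D" "- \<Delta>t * \<zeta> * D \<le> 0"
proof -
  show eq: "R' - R = - \<Delta>t * \<zeta> * D"
    using step \<open>0 < \<Delta>t\<close> by (simp add: field_simps)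
  have "R' * (1 + \<Delta>t * D / w) = R"
    using eq \<open>0 < w\<close> by (simp add: ratio field_simps)
  moreover have "0 < 1 + \<Delta>t * D / w"
    using assms by (simp add: add_pos_nonneg)
  ultimately show "0 \<le> R'"
    using \<open>0 \<le> R\<close> by (metis zero_le_mult_iff not_less)
  then show "0 \<le> \<zeta>"
    using \<open>0 < w\<close> by (simp add: ratio)
  then have "0 \<le> \<Delta>t * \<zeta> * D"
    using assms(1,3) by (intro mult_nonneg_nonneg) auto
  then show "- \<Delta>t * \<zeta> * D \<le> 0"
    by simp
  then show "R' \<le> R"
    using eq by linarith
qed

text \<open>All the methods share the scalar update and the final rescaling; the variants differ only in
  the equation for the normal velocity and in the choice of the approximating surface.\<close>

lemma SAV_solutionD:
  assumes "SAV_solution q0 \<gamma> s C r \<Delta>t \<rho>"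
  shows "initial_data q0 \<gamma> C \<rho>" "common_step q0 \<gamma> s C r \<Delta>t \<rho> m"
  using assms by (auto simp: SAV_solution_def SAV_MD_BDF_def VC_SAV_MD_BDF1_def Let_def)

lemma Wc_pos:
  assumes "surface_energy_density \<gamma>" "0 < C"
  shows "0 < Wc \<gamma> C q X"
  using W_nonneg[OF assms(1), of q X] assms(2) by (simp add: Wc_def)

lemma R_initial:
  assumes "SAV_solution q0 \<gamma> s C r \<Delta>t \<rho>"
  shows "R_of \<rho> 0 = Wc \<gamma> C q0 (\<lambda>x. x)"
proof -
  have "\<And>x. x \<in> surface q0 \<Longrightarrow> X_of \<rho> 0 x = x" "R_of \<rho> 0 = Wc \<gamma> C q0 (X_of \<rho> 0)"
    using SAV_solutionD(1)[OF assms] by (auto simp: initial_data_def)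
  then show ?thesis
    using W_cong[of q0 "X_of \<rho> 0" "\<lambda>x. x" \<gamma>] by (simp add: Wc_def)
qed

lemma SAV_auxiliary_step:
  assumes "surface_energy_density \<gamma>" "0 < C" "0 < \<Delta>t" "SAV_solution q0 \<gamma> s C r \<Delta>t \<rho>"
    and "0 \<le> R_of \<rho> m"
  shows "0 \<le> R_of \<rho> (m+1)" "R_of \<rho> (m+1) \<le> R_of \<rho> m" "0 \<le> zeta_of \<rho> (m+1)"
    and "R_of \<rho> (m+1) - R_of \<rho> m = - \<Delta>t * zeta_of \<rho> (m+1) * dissipation q0 \<rho> (m+1)"
    and "- \<Delta>t * zeta_of \<rho> (m+1) * dissipation q0 \<rho> (m+1) \<le> 0"
proof -
  have e: "(R_of \<rho> (m+1) - R_of \<rho> m) / \<Delta>t = - zeta_of \<rho> (m+1) * dissipation q0 \<rho> (m+1)"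
    "zeta_of \<rho> (m+1) = R_of \<rho> (m+1) / Wc \<gamma> C q0 (Xb_of \<rho> (m+1))"
    using SAV_solutionD(2)[OF assms(4), of m] by (simp_all add: common_step_def eq_e_def)
  note step = auxiliary_energy_step[OF assms(3) Wc_pos[OF assms(1,2)] dissipation_nonneg assms(5) e]
  show "0 \<le> R_of \<rho> (m+1)" "R_of \<rho> (m+1) \<le> R_of \<rho> m" "0 \<le> zeta_of \<rho> (m+1)"
    "R_of \<rho> (m+1) - R_of \<rho> m = - \<Delta>t * zeta_of \<rho> (m+1) * dissipation q0 \<rho> (m+1)"
    "- \<Delta>t * zeta_of \<rho> (m+1) * dissipation q0 \<rho> (m+1) \<le> 0"
    by (fact step)+
qed

lemma auxiliary_energy_bounds:
  assumes "surface_energy_density \<gamma>" "0 < C" "0 < \<Delta>t" "SAV_solution q0 \<gamma> s C r \<Delta>t \<rho>"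
  shows "0 \<le> R_of \<rho> m \<and> R_of \<rho> m \<le> Wc \<gamma> C q0 (\<lambda>x. x)"
proof (induction m)
  case 0
  then show ?case
    using R_initial[OF assms(4)] Wc_pos[OF assms(1,2), of q0 "\<lambda>x. x"] by simp
next
  case (Suc m)
  then show ?case
    using SAV_auxiliary_step(1,2)[OF assms, of m] by simp
qed

section \<open>Boundedness of the original energy\<close>

text \<open>The factorization \<open>1 - (1 - z)\<^sup>r = z (1 + (1 - z) + \<dots> + (1 - z)\<^sup>r\<^sup>-\<^sup>1)\<close> turns smallness of
  \<open>z\<close> into smallness of the relaxation factor. The constant is crude, but it depends only on \<open>r\<close>
  and \<open>b\<close>.\<close>

lemma relaxation_factor_bound:
  fixes z b :: real
  assumes "0 \<le> z" "z \<le> b"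
  shows "\<bar>1 - (1 - z) ^ r\<bar> \<le> real r * (1 + b) ^ r * z"
proof -
  have "\<bar>\<Sum>i<r. (1 - z) ^ i\<bar> \<le> (\<Sum>i<r. (1 + b) ^ r)"
  proof (rule order_trans[OF sum_abs sum_mono])
    fix i assume "i \<in> {..<r}"
    have "\<bar>(1 - z) ^ i\<bar> \<le> (1 + b) ^ i"
      unfolding power_abs using assms by (intro power_mono) auto
    also have "\<dots> \<le> (1 + b) ^ r"
      using \<open>i \<in> {..<r}\<close> assms by (intro power_increasing) auto
    finally show "\<bar>(1 - z) ^ i\<bar> \<le> (1 + b) ^ r" .
  qed
  then have "z * \<bar>\<Sum>i<r. (1 - z) ^ i\<bar> \<le> z * (real r * (1 + b) ^ r)"
    using assms(1) by (intro mult_left_mono) auto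
  moreover have "1 - (1 - z) ^ r = z * (\<Sum>i<r. (1 - z) ^ i)"
    using one_diff_power_eq[of "1 - z" r] by simp
  ultimately show ?thesis
    using assms(1) by (simp add: abs_mult mult_ac)
qed

text \<open>One factor \<open>w\<close> from the unrelaxed surface is outweighed by the \<open>1 / w\<^sup>2\<close> hidden in the squared
  relaxation factor, since \<open>\<zeta> = R / w\<close>; this is why the bound does not involve \<open>w\<close>.\<close>

lemma relaxed_energy_bound:
  fixes R R\<^sub>0 C w :: real
  assumes "0 < C" "C \<le> w" "0 \<le> R" "R \<le> R\<^sub>0"
  shows "(1 - (1 - R / w) ^ r)\<^sup>2 * w \<le> (real r * (1 + R\<^sub>0 / C) ^ r * R\<^sub>0)\<^sup>2 / C"
proof -
  define B where "B = real r * (1 + R\<^sub>0 / C) ^ r"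
  have "0 < w" "0 \<le> R\<^sub>0" "0 \<le> B"
    using assms by (auto simp: B_def)
  have "0 \<le> R / w"
    using \<open>0 \<le> R\<close> \<open>0 < w\<close> by simp
  moreover have "R / w \<le> R\<^sub>0 / C"
    using assms by (intro frac_le) auto
  ultimately have "\<bar>1 - (1 - R / w) ^ r\<bar> \<le> B * (R / w)"
    unfolding B_def by (rule relaxation_factor_bound)
  also have "\<dots> \<le> B * (R\<^sub>0 / w)"
    using assms \<open>0 < w\<close> \<open>0 \<le> B\<close> by (intro mult_left_mono divide_right_mono) auto
  finally have "(1 - (1 - R / w) ^ r)\<^sup>2 \<le> (B * (R\<^sub>0 / w))\<^sup>2"
    by (rule power2_le_iff_abs_le[THEN iffD2, rotated]) (use \<open>0 < w\<close> \<open>0 \<le> R\<^sub>0\<close> \<open>0 \<le> B\<close> in simp)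
  then have "(1 - (1 - R / w) ^ r)\<^sup>2 * w \<le> (B * (R\<^sub>0 / w))\<^sup>2 * w"
    using \<open>0 < w\<close> by (intro mult_right_mono) auto
  also have "\<dots> = (B * R\<^sub>0)\<^sup>2 / w"
    using \<open>0 < w\<close> by (simp add: power2_eq_square)
  also have "\<dots> \<le> (B * R\<^sub>0)\<^sup>2 / C"
    using assms by (intro divide_left_mono) auto
  finally show ?thesis
    by (simp add: B_def)
qed

lemma original_energy_step_bound:
  fixes q0 :: "'l::finite mesh"
  assumes "surface_energy_density \<gamma>" "0 < C" "0 < \<Delta>t" "SAV_solution q0 \<gamma> s C r \<Delta>t \<rho>"
  defines "R\<^sub>0 \<equiv> Wc \<gamma> C q0 (\<lambda>x. x)"
  shows "W \<gamma> q0 (X_of \<rho> (m+1)) \<le> (real r * (1 + R\<^sub>0 / C) ^ r * R\<^sub>0)\<^sup>2 / C"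
proof -
  define w where "w = Wc \<gamma> C q0 (Xb_of \<rho> (m+1))"
  have zeta: "zeta_of \<rho> (m+1) = R_of \<rho> (m+1) / w"
    and eta: "eta_of \<rho> (m+1) = 1 - (1 - zeta_of \<rho> (m+1)) ^ r"
    and X: "\<And>x. x \<in> surface q0 \<Longrightarrow> X_of \<rho> (m+1) x = eta_of \<rho> (m+1) *\<^sub>R Xb_of \<rho> (m+1) x"
    using SAV_solutionD(2)[OF assms(4), of m]
    by (auto simp: common_step_def eq_e_def eq_f_def eq_g_def Let_def w_def)
  have "W \<gamma> q0 (X_of \<rho> (m+1)) = (eta_of \<rho> (m+1))\<^sup>2 * W \<gamma> q0 (Xb_of \<rho> (m+1))"
    using W_cong[OF X] by (simp add: W_dilation)
  also have "\<dots> \<le> (eta_of \<rho> (m+1))\<^sup>2 * w"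
    using assms(2) by (intro mult_left_mono) (auto simp: w_def Wc_def)
  also have "\<dots> \<le> (real r * (1 + R\<^sub>0 / C) ^ r * R\<^sub>0)\<^sup>2 / C"
    unfolding eta zeta
  proof (rule relaxed_energy_bound[OF assms(2)])
    show "C \<le> w"
      using W_nonneg[OF assms(1)] by (simp add: w_def Wc_def)
    show "0 \<le> R_of \<rho> (m+1)" "R_of \<rho> (m+1) \<le> R\<^sub>0"
      using auxiliary_energy_bounds[OF assms(1-4)] by (auto simp: R\<^sub>0_def)
  qed
  finally show ?thesis .
qed

theorem theorem3p1:
  fixes q0 :: "'l::finite mesh" and \<gamma> s :: "real^3 \<Rightarrow> real" and C :: real and r :: nat
  assumes "closed_oriented_surface q0"
    and "surface_energy_density \<gamma>"
    and "stability_function \<gamma> s"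
    and "C > 0"
    and "r \<ge> 1"
  shows "(\<forall>\<Delta>t \<rho>. \<Delta>t > 0 \<and> SAV_solution q0 \<gamma> s C r \<Delta>t \<rho> \<longrightarrow>
            (\<forall>m. R_of \<rho> (m+1) \<ge> 0 \<and> zeta_of \<rho> (m+1) \<ge> 0) \<and>
            (\<forall>m. R_of \<rho> (m+1) - R_of \<rho> m = - \<Delta>t * zeta_of \<rho> (m+1) * dissipation q0 \<rho> (m+1) \<and>
                 - \<Delta>t * zeta_of \<rho> (m+1) * dissipation q0 \<rho> (m+1) \<le> 0))
       \<and> (\<exists>M>0. \<forall>\<Delta>t \<rho>. \<Delta>t > 0 \<and> SAV_solution q0 \<gamma> s C r \<Delta>t \<rho> \<longrightarrow>
            (\<forall>m. W \<gamma> q0 (X_of \<rho> m) \<le> M\<^sup>2))"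
proof (intro conjI)
  show "\<forall>\<Delta>t \<rho>. \<Delta>t > 0 \<and> SAV_solution q0 \<gamma> s C r \<Delta>t \<rho> \<longrightarrow>
          (\<forall>m. R_of \<rho> (m+1) \<ge> 0 \<and> zeta_of \<rho> (m+1) \<ge> 0) \<and>
          (\<forall>m. R_of \<rho> (m+1) - R_of \<rho> m = - \<Delta>t * zeta_of \<rho> (m+1) * dissipation q0 \<rho> (m+1) \<and>
               - \<Delta>t * zeta_of \<rho> (m+1) * dissipation q0 \<rho> (m+1) \<le> 0)"
  proof (intro allI impI)
    fix \<Delta>t \<rho>
    assume "\<Delta>t > 0 \<and> SAV_solution q0 \<gamma> s C r \<Delta>t \<rho>"
    then have run: "0 < \<Delta>t" "SAV_solution q0 \<gamma> s C r \<Delta>t \<rho>"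
      by auto
    have "0 \<le> R_of \<rho> m" for m
      using auxiliary_energy_bounds[OF assms(2,4) run] by blast
    note step = SAV_auxiliary_step[OF assms(2,4) run this]
    show "(\<forall>m. R_of \<rho> (m+1) \<ge> 0 \<and> zeta_of \<rho> (m+1) \<ge> 0) \<and>
          (\<forall>m. R_of \<rho> (m+1) - R_of \<rho> m = - \<Delta>t * zeta_of \<rho> (m+1) * dissipation q0 \<rho> (m+1) \<and>
               - \<Delta>t * zeta_of \<rho> (m+1) * dissipation q0 \<rho> (m+1) \<le> 0)"
      by (intro conjI allI step)
  qed
  define R\<^sub>0 where "R\<^sub>0 = Wc \<gamma> C q0 (\<lambda>x. x)"
  \<comment> \<open>The first summand covers the initial surface, the second every later one.\<close>
  define K where "K = R\<^sub>0 + (real r * (1 + R\<^sub>0 / C) ^ r * R\<^sub>0)\<^sup>2 / C"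
  have "0 < R\<^sub>0"
    unfolding R\<^sub>0_def by (rule Wc_pos[OF assms(2,4)])
  then have "0 < K"
    using assms(4) by (simp add: K_def add_pos_nonneg)
  have "W \<gamma> q0 (X_of \<rho> m) \<le> K" if "\<Delta>t > 0" and sol: "SAV_solution q0 \<gamma> s C r \<Delta>t \<rho>" for \<Delta>t \<rho> m
  proof (cases m)
    case 0
    have "W \<gamma> q0 (X_of \<rho> 0) \<le> R_of \<rho> 0"
      using SAV_solutionD(1)[OF sol] assms(4) by (simp add: initial_data_def Wc_def)
    also have "\<dots> = R\<^sub>0"
      unfolding R\<^sub>0_def by (rule R_initial[OF sol])
    also have "\<dots> \<le> K"
      using assms(4) by (simp add: K_def)
    finally show ?thesis
      using 0 by simp
  next
    case (Suc n)
    then show ?thesis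
      using original_energy_step_bound[OF assms(2,4) that, of n] \<open>0 < R\<^sub>0\<close>
      by (simp add: K_def R\<^sub>0_def)
  qed
  then show "\<exists>M>0. \<forall>\<Delta>t \<rho>. \<Delta>t > 0 \<and> SAV_solution q0 \<gamma> s C r \<Delta>t \<rho> \<longrightarrow>
               (\<forall>m. W \<gamma> q0 (X_of \<rho> m) \<le> M\<^sup>2)"
    using \<open>0 < K\<close> by (intro exI[of _ "sqrt K"]) auto
qed

end
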